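(* Let $m\in[-\frac12,\frac12]\setminus\{0\}$, $\omega\in(-1,1]$, $\rho_0>0$, $t_0\in\mathbb{R}$, and choose a sign $\pm$. Put $$a_2=\tfrac12\left(1\pm\sqrt{1-4m^2}\right),\quad h=1+2a_2,\quad \gamma=(\omega+1)h,\quad A=2a_2+a_2^2-m^2 .$$ Then, for $t>-t_0$, the functions $$a=t+t_0,\quad b=d=(t+t_0)^{a_2},\quad \rho=\rho_0(t+t_0)^{-\gamma},\quad G=\frac{A}{4\pi\rho_0\gamma}(t+t_0)^{\gamma-2},\quad \Lambda=A\left(1-\frac2\gamma\right)(t+t_0)^{-2}$$ form a solution of the Bianchi $\mathrm{VI}_0$ perfect fluid field equations with time-varying $G$ and $\Lambda$ (listed in the context). Moreover, if $(\omega+1)h<2$ then $G$ is decreasing and $\Lambda<0$; if $(\omega+1)h=2$ then $G$ is constant and $\Lambda=0$; if $(\omega+1)h>2$ then $G$ is growing and $\Lambda>0$.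
   Context: A prime denotes $d/dt$. The unknowns are the positive scale factors $a(t),b(t),d(t)$ of the Bianchi $\mathrm{VI}_0$ metric $ds^2=-dt^2+a^2dx^2+(b^2\cosh^2mx+d^2\sinh^2mx)dy^2-2(b^2+d^2)\cosh mx\,\sinh mx\,dy\,dz+(b^2\sinh^2mx+d^2\cosh^2mx)dz^2$, the energy density $\rho(t)$ of a perfect fluid with pressure $p=\omega\rho$, and the functions $G(t)$, $\Lambda(t)$. The field equations (units $c=1$) are: $$\frac{a'}{a}\frac{b'}{b}+\frac{a'}{a}\frac{d'}{d}+\frac{d'}{d}\frac{b'}{b}-\Big(2+\frac{b^2}{d^2}+\frac{d^2}{b^2}\Big)\frac{m^2}{4a^2}=8\pi G\rho+\Lambda,$$ $$\frac{b''}{b}+\frac{d''}{d}+\frac{d'}{d}\frac{b'}{b}+\Big(2+\frac{b^2}{d^2}+\frac{d^2}{b^2}\Big)\frac{m^2}{4a^2}=-8\pi G\omega\rho+\Lambda,$$ $$\frac{a''}{a}+\frac{b''}{b}+\frac{a'}{a}\frac{b'}{b}-\Big(2+\frac{3d^2}{b^2}-\frac{b^2}{d^2}\Big)\frac{m^2}{4a^2}=-8\pi G\omega\rho+\Lambda,$$ $$\frac{b''}{b}-\frac{d''}{d}+\frac{a'}{a}\frac{b'}{b}-\frac{a'}{a}\frac{d'}{d}+m^2\Big(\frac{b^2}{d^2a^2}-\frac{d^2}{b^2a^2}\Big)=0,$$ $$\frac{d''}{d}+\frac{a''}{a}+\frac{a'}{a}\frac{d'}{d}-\Big(2+\frac{3b^2}{d^2}-\frac{d^2}{b^2}\Big)\frac{m^2}{4a^2}=-8\pi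 G\omega\rho+\Lambda,$$ $$\rho'+\rho(1+\omega)\Big(\frac{a'}{a}+\frac{b'}{b}+\frac{d'}{d}\Big)=0,\qquad \Lambda'=-8\pi G'\rho .$$ *)

theory Defs
  imports "HOL-Analysis.Analysis"
begin

text \<open>
  Field equations, in units with c = 1, for the Bianchi VI0 metric with scale factors
  a, b, d and structure parameter m,
    ds^2 = - dt^2 + a^2 dx^2 + (b^2 cosh^2 mx + d^2 sinh^2 mx) dy^2
           - 2 (b^2 + d^2) cosh mx sinh mx dy dz + (b^2 sinh^2 mx + d^2 cosh^2 mx) dz^2,
  a perfect fluid with pressure \<omega> \<rho>, and time-varying G and \<Lambda>.
\<close>

definition bianchi_VI0_field_eqs ::
  "real \<Rightarrow> real \<Rightarrow> (real \<Rightarrow> real) \<Rightarrow> (real \<Rightarrow> real) \<Rightarrow> (real \<Rightarrow> real) \<Rightarrow>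
   (real \<Rightarrow> real) \<Rightarrow> (real \<Rightarrow> real) \<Rightarrow> (real \<Rightarrow> real) \<Rightarrow> real \<Rightarrow> bool"
  where
  "bianchi_VI0_field_eqs m \<omega> a b d \<rho> G \<Lambda> t \<longleftrightarrow>
     deriv a t / a t * (deriv b t / b t) + deriv a t / a t * (deriv d t / d t)
       + deriv d t / d t * (deriv b t / b t)
       - (2 + (b t)\<^sup>2 / (d t)\<^sup>2 + (d t)\<^sup>2 / (b t)\<^sup>2) * (m\<^sup>2 / (4 * (a t)\<^sup>2))
       = 8 * pi * G t * \<rho> t + \<Lambda> t \<and>
     deriv (deriv b) t / b t + deriv (deriv d) t / d t + deriv d t / d t * (deriv b t / b t)
       + (2 + (b t)\<^sup>2 / (d t)\<^sup>2 + (d t)\<^sup>2 / (b t)\<^sup>2) * (m\<^sup>2 / (4 * (a t)\<^sup>2))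
       = - 8 * pi * G t * \<omega> * \<rho> t + \<Lambda> t \<and>
     deriv (deriv a) t / a t + deriv (deriv b) t / b t + deriv a t / a t * (deriv b t / b t)
       - (2 + 3 * (d t)\<^sup>2 / (b t)\<^sup>2 - (b t)\<^sup>2 / (d t)\<^sup>2) * (m\<^sup>2 / (4 * (a t)\<^sup>2))
       = - 8 * pi * G t * \<omega> * \<rho> t + \<Lambda> t \<and>
     deriv (deriv b) t / b t - deriv (deriv d) t / d t
       + deriv a t / a t * (deriv b t / b t) - deriv a t / a t * (deriv d t / d t)
       + m\<^sup>2 * ((b t)\<^sup>2 / ((d t)\<^sup>2 * (a t)\<^sup>2) - (d t)\<^sup>2 / ((b t)\<^sup>2 * (a t)\<^sup>2))
       = 0 \<and>
     deriv (deriv d) t / d t + deriv (deriv a) t / a t + deriv a t / a t * (deriv d t / d t)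
       - (2 + 3 * (b t)\<^sup>2 / (d t)\<^sup>2 - (d t)\<^sup>2 / (b t)\<^sup>2) * (m\<^sup>2 / (4 * (a t)\<^sup>2))
       = - 8 * pi * G t * \<omega> * \<rho> t + \<Lambda> t \<and>
     deriv \<rho> t + \<rho> t * (1 + \<omega>) * (deriv a t / a t + deriv b t / b t + deriv d t / d t) = 0 \<and>
     deriv \<Lambda> t = - 8 * pi * deriv G t * \<rho> t"

text \<open>
  Differentiability is demanded separately because \<open>deriv\<close> is total. The set T is
  meant to be open, so that the two-sided derivatives only depend on the functions on T.
\<close>

definition bianchi_VI0_solution_on ::
  "real set \<Rightarrow> real \<Rightarrow> real \<Rightarrow> (real \<Rightarrow> real) \<Rightarrow> (real \<Rightarrow> real) \<Rightarrow> (real \<Rightarrow> real) \<Rightarrow>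
   (real \<Rightarrow> real) \<Rightarrow> (real \<Rightarrow> real) \<Rightarrow> (real \<Rightarrow> real) \<Rightarrow> bool"
  where
  "bianchi_VI0_solution_on T m \<omega> a b d \<rho> G \<Lambda> \<longleftrightarrow>
     (\<forall>t\<in>T.
        (\<forall>f\<in>{a, b, d}. f t > 0 \<and> f differentiable at t \<and> deriv f differentiable at t) \<and>
        (\<forall>f\<in>{\<rho>, G, \<Lambda>}. f differentiable at t) \<and>
        bianchi_VI0_field_eqs m \<omega> a b d \<rho> G \<Lambda> t)"

end

(*
  Every unknown is a power law c s^p in s = t + t0, so its logarithmic derivative is p/s and
  each field equation is an algebraic identity divided by s^2. The choice of a2 makes
  m^2 = a2 - a2^2, hence A = a2 h, and this solves the three pressure equations. Since a2 > 0,
  also A > 0 and \<gamma> > 0, so the signs of G' and \<Lambda> are both the sign of \<gamma> - 2.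
*)
theory Submission
  imports Defs
begin

text \<open>Writing the derivative as a multiple of \<open>f t\<close> makes the logarithmic
  derivative \<open>p / (t + t0)\<close> immediate. The formula for \<open>f\<close> is known only
  on the open half-line, which suffices because differentiability is local.\<close>

lemma power_law_has_derivative:
  fixes f :: "real \<Rightarrow> real"
  assumes f: "\<And>t. t > - t0 \<Longrightarrow> f t = c * (t + t0) powr p" and t: "t > - t0"
  shows "(f has_real_derivative p / (t + t0) * f t) (at t)"
proof -
  have "((\<lambda>t. c * (t + t0) powr p) has_real_derivative c * (p * (t + t0) powr (p - 1))) (at t)"
    using t by (auto intro!: derivative_eq_intros)
  moreover have "c * (p * (t + t0) powr (p - 1)) = p / (t + t0) * f t"
    using t by (simp add: f powr_diff)
  ultimately show ?thesis
    using t by (auto intro: has_field_derivative_transform_within_open[where S = "{- t0<..}"] simp: f)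
qed

text \<open>On the half-line \<open>deriv f\<close> is again a power law, with coefficient
  \<open>c * p\<close> and exponent \<open>p - 1\<close>, so the first-derivative lemma applies to
  it.\<close>

lemma power_law_has_second_derivative:
  fixes f :: "real \<Rightarrow> real"
  assumes f: "\<And>t. t > - t0 \<Longrightarrow> f t = c * (t + t0) powr p" and t: "t > - t0"
  shows "(deriv f has_real_derivative p * (p - 1) / (t + t0)\<^sup>2 * f t) (at t)"
proof -
  have f': "deriv f t = (c * p) * (t + t0) powr (p - 1)" if "t > - t0" for t
    using DERIV_imp_deriv[OF power_law_has_derivative[OF f that]] f[OF that] that
    by (simp add: powr_diff)
  have "(p - 1) / (t + t0) * deriv f t = p * (p - 1) / (t + t0)\<^sup>2 * f t"
    using DERIV_imp_deriv[OF power_law_has_derivative[OF f t]] by (simp add: power2_eq_square)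
  with power_law_has_derivative[OF f' t] show ?thesis
    by simp
qed

text \<open>The algebraic core. The relation \<open>m\<^sup>2 = a2 - a2\<^sup>2\<close> replaces the
  explicit root, so both signs are handled at once.\<close>

lemma power_law_solution:
  fixes a b d \<rho> G \<Lambda> :: "real \<Rightarrow> real"
  assumes a: "\<And>t. t > - t0 \<Longrightarrow> a t = t + t0"
    and b: "\<And>t. t > - t0 \<Longrightarrow> b t = (t + t0) powr a2"
    and d: "\<And>t. t > - t0 \<Longrightarrow> d t = (t + t0) powr a2"
    and \<rho>: "\<And>t. t > - t0 \<Longrightarrow> \<rho> t = \<rho>0 * (t + t0) powr (- \<gamma>)"
    and G: "\<And>t. t > - t0 \<Longrightarrow> G t = A / (4 * pi * \<rho>0 * \<gamma>) * (t + t0) powr (\<gamma> - 2)"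
    and \<Lambda>: "\<And>t. t > - t0 \<Longrightarrow> \<Lambda> t = A * (1 - 2 / \<gamma>) * (t + t0) powr (-2)"
    and \<gamma>: "\<gamma> = (\<omega> + 1) * (1 + 2 * a2)" "\<gamma> \<noteq> 0"
    and A: "A = 2 * a2 + a2\<^sup>2 - m\<^sup>2"
    and m: "m\<^sup>2 = a2 - a2\<^sup>2"
    and "\<rho>0 \<noteq> 0"
  shows "bianchi_VI0_solution_on {- t0<..} m \<omega> a b d \<rho> G \<Lambda>"
  unfolding bianchi_VI0_solution_on_def
proof (intro ballI)
  fix t assume "t \<in> {- t0<..}"
  then have t: "t > - t0" by simp
  define s where "s = t + t0"
  have s: "s > 0" using t by (simp add: s_def)
  have a': "a t = 1 * (t + t0) powr 1" if "t > - t0" for t using a that by simp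
  have b': "b t = 1 * (t + t0) powr a2" if "t > - t0" for t using b that by simp
  have d': "d t = 1 * (t + t0) powr a2" if "t > - t0" for t using d that by simp
  note D = power_law_has_derivative[OF a' t] power_law_has_derivative[OF b' t]
    power_law_has_derivative[OF d' t] power_law_has_derivative[OF \<rho> t]
    power_law_has_derivative[OF G t] power_law_has_derivative[OF \<Lambda> t]
  note D2 = power_law_has_second_derivative[OF a' t] power_law_has_second_derivative[OF b' t]
    power_law_has_second_derivative[OF d' t]
  note derivs = D[folded s_def, THEN DERIV_imp_deriv] D2[folded s_def, THEN DERIV_imp_deriv]
  have diff: "f differentiable at t" if "(f has_real_derivative D) (at t)" for f D
    using that real_differentiable_def by blast
  have at: "a t = s" and bt: "b t > 0" and dt: "d t = b t"
    using t by (simp_all add: a b d s_def)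
  have s2: "s powr - 2 = 1 / s\<^sup>2"
    using s by (simp add: powr_minus_divide)
  have \<Lambda>t: "\<Lambda> t = A * (1 - 2 / \<gamma>) / s\<^sup>2"
    using \<Lambda>[OF t] by (simp add: s2 flip: s_def)
  \<comment> \<open>The exponents \<open>\<gamma> - 2\<close> and \<open>- \<gamma>\<close> add up
    to -2 and \<open>\<rho>0\<close> cancels, so the matter term scales like
    \<open>\<Lambda>\<close> and the curvature terms.\<close>
  have "G t * \<rho> t = A / (4 * pi * \<gamma>) * (s powr (\<gamma> - 2) * s powr (- \<gamma>))"
    using G[OF t] \<rho>[OF t] \<open>\<rho>0 \<noteq> 0\<close> by (simp flip: s_def)
  also have "s powr (\<gamma> - 2) * s powr (- \<gamma>) = 1 / s\<^sup>2"
    using s2 by (simp flip: powr_add)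
  finally have G\<rho>: "8 * pi * (G t * \<rho> t) = 2 * A / \<gamma> / s\<^sup>2"
    using \<open>\<gamma> \<noteq> 0\<close> by (simp add: field_simps)
  have log_derivs: "deriv a t / a t = 1 / s" "deriv b t / b t = a2 / s" "deriv d t / d t = a2 / s"
    "deriv (deriv a) t / a t = 0" "deriv (deriv b) t / b t = a2 * (a2 - 1) / s\<^sup>2"
    "deriv (deriv d) t / d t = a2 * (a2 - 1) / s\<^sup>2"
    using s bt by (simp_all add: derivs at dt)
  have ratio: "(b t)\<^sup>2 / (d t)\<^sup>2 = 1" "(d t)\<^sup>2 / (b t)\<^sup>2 = 1"
    "3 * (b t)\<^sup>2 / (d t)\<^sup>2 = 3" "3 * (d t)\<^sup>2 / (b t)\<^sup>2 = 3"
    using bt by (simp_all add: dt)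
  have A': "A = a2 * (1 + 2 * a2)"
    using A m by (simp add: algebra_simps power2_eq_square)
  have h: "1 + 2 * a2 \<noteq> 0" and \<omega>: "\<omega> + 1 \<noteq> 0"
    using \<gamma> by auto
  \<comment> \<open>This is the common right-hand side of the three pressure equations. As \<gamma>
    = (\<omega> + 1) h and A = a2 h with h = 1 + 2 a2, its coefficient is A (1 - 2/h) = a2 (h - 2),
    which is free of \<omega>.\<close>
  have "- 8 * pi * G t * \<omega> * \<rho> t + \<Lambda> t = - \<omega> * (8 * pi * (G t * \<rho> t)) + \<Lambda> t"
    by simp
  also have "\<dots> = A * (1 - 2 * (\<omega> + 1) / \<gamma>) / s\<^sup>2"
    unfolding G\<rho> \<Lambda>t using s \<open>\<gamma> \<noteq> 0\<close> by (simp add: field_simps)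
  also have "A * (1 - 2 * (\<omega> + 1) / \<gamma>) = 2 * a2\<^sup>2 - a2"
  proof -
    have "2 * (\<omega> + 1) / \<gamma> = 2 / (1 + 2 * a2)"
      using \<omega> by (simp add: \<gamma>(1) del: distrib_left_numeral)
    then show ?thesis
      unfolding A' using h by (simp only:) (simp add: field_simps power2_eq_square)
  qed
  finally have pressure: "- 8 * pi * G t * \<omega> * \<rho> t + \<Lambda> t = (2 * a2\<^sup>2 - a2) / s\<^sup>2" .
  have "8 * pi * G t * \<rho> t + \<Lambda> t = 8 * pi * (G t * \<rho> t) + \<Lambda> t"
    by simp
  also have "\<dots> = A / s\<^sup>2"
    unfolding G\<rho> \<Lambda>t using \<open>\<gamma> \<noteq> 0\<close> s by (simp add: field_simps)
  finally have energy: "8 * pi * G t * \<rho> t + \<Lambda> t = A / s\<^sup>2" .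
  \<comment> \<open>The three expansion rates sum to h/s, and (1 + \<omega>) h/s = \<gamma>/s
    cancels the logarithmic derivative of \<rho>.\<close>
  have fluid: "deriv \<rho> t + \<rho> t * (1 + \<omega>) * (1 / s + a2 / s + a2 / s) = 0"
    using s by (simp add: derivs \<gamma>(1) field_simps)
  \<comment> \<open>G'/G = (\<gamma> - 2)/s, and (\<gamma> - 2) 2A/\<gamma> = 2A (1 - 2/\<gamma>);
    the result is the derivative of \<Lambda>, a multiple of \<open>s powr -2\<close>.\<close>
  have "- 8 * pi * deriv G t * \<rho> t = - (\<gamma> - 2) / s * (8 * pi * (G t * \<rho> t))"
    using s by (simp add: derivs field_simps)
  also have "\<dots> = - 2 / s * \<Lambda> t"
    unfolding G\<rho> \<Lambda>t using s \<open>\<gamma> \<noteq> 0\<close> by (simp add: field_simps)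
  finally have cosm: "deriv \<Lambda> t = - 8 * pi * deriv G t * \<rho> t"
    by (simp only: derivs(6))
  have "bianchi_VI0_field_eqs m \<omega> a b d \<rho> G \<Lambda> t"
    \<comment> \<open>Since b = d, every curvature bracket equals 4 and the fourth equation is
      trivial. The others become polynomial identities in \<open>a2\<close> over
      \<open>s\<^sup>2\<close> once \<open>m\<^sup>2\<close> is eliminated.\<close>
    unfolding bianchi_VI0_field_eqs_def log_derivs ratio energy pressure
    unfolding at dt A m
    by (intro conjI fluid cosm)
      (use s bt in \<open>simp_all add: field_simps, simp_all add: power_numeral_reduce algebra_simps\<close>)
  moreover have "\<forall>f\<in>{a, b, d}. f t > 0 \<and> f differentiable at t \<and> deriv f differentiable at t"
    using s at bt dt D[THEN diff] D2[THEN diff] by simp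
  moreover have "\<forall>f\<in>{\<rho>, G, \<Lambda>}. f differentiable at t"
    using D[THEN diff] by simp
  ultimately show "(\<forall>f\<in>{a, b, d}. f t > 0 \<and> f differentiable at t \<and> deriv f differentiable at t) \<and>
      (\<forall>f\<in>{\<rho>, G, \<Lambda>}. f differentiable at t) \<and> bianchi_VI0_field_eqs m \<omega> a b d \<rho> G \<Lambda> t"
    by blast
qed

theorem mainTheorem2:
  fixes m \<omega> \<rho>0 t0 \<sigma> a2 h \<gamma> A :: real
    and a b d \<rho> G \<Lambda> :: "real \<Rightarrow> real"
  assumes "m \<in> {-1/2..1/2} - {0}"
    and "\<omega> \<in> {-1<..1}"
    and "\<rho>0 > 0"
    and "\<sigma> \<in> {1, -1}"
    and "a2 = 1/2 * (1 + \<sigma> * sqrt (1 - 4 * m\<^sup>2))"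
    and "h = 1 + 2 * a2"
    and "\<gamma> = (\<omega> + 1) * h"
    and "A = 2 * a2 + a2\<^sup>2 - m\<^sup>2"
    and "\<And>t. t > - t0 \<Longrightarrow> a t = t + t0"
    and "\<And>t. t > - t0 \<Longrightarrow> b t = (t + t0) powr a2"
    and "\<And>t. t > - t0 \<Longrightarrow> d t = (t + t0) powr a2"
    and "\<And>t. t > - t0 \<Longrightarrow> \<rho> t = \<rho>0 * (t + t0) powr (- \<gamma>)"
    and "\<And>t. t > - t0 \<Longrightarrow> G t = A / (4 * pi * \<rho>0 * \<gamma>) * (t + t0) powr (\<gamma> - 2)"
    and "\<And>t. t > - t0 \<Longrightarrow> \<Lambda> t = A * (1 - 2 / \<gamma>) * (t + t0) powr (-2)"
  shows "bianchi_VI0_solution_on {- t0<..} m \<omega> a b d \<rho> G \<Lambda>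
    \<and> ((\<omega> + 1) * h < 2 \<longrightarrow> strict_antimono_on {- t0<..} G \<and> (\<forall>t > - t0. \<Lambda> t < 0))
    \<and> ((\<omega> + 1) * h = 2 \<longrightarrow> G constant_on {- t0<..} \<and> (\<forall>t > - t0. \<Lambda> t = 0))
    \<and> ((\<omega> + 1) * h > 2 \<longrightarrow> strict_mono_on {- t0<..} G \<and> (\<forall>t > - t0. \<Lambda> t > 0))"
proof -
  note G = assms(13) and \<Lambda> = assms(14)
  have "\<bar>m\<bar> \<le> 1/2" "m \<noteq> 0"
    using assms(1) by auto
  then have "m\<^sup>2 \<le> (1/2)\<^sup>2" "m\<^sup>2 > 0"
    by (auto simp: abs_le_square_iff[symmetric])
  then have m: "0 \<le> 1 - 4 * m\<^sup>2" "1 - 4 * m\<^sup>2 < 1"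
    by (auto simp: power2_eq_square)
  define r where "r = sqrt (1 - 4 * m\<^sup>2)"
  \<comment> \<open>The strict bound \<open>r < 1\<close> comes from \<open>m \<noteq> 0\<close>; it
    keeps \<open>a2\<close> positive for the minus sign as well.\<close>
  have r: "0 \<le> r" "r < 1" "r\<^sup>2 = 1 - 4 * m\<^sup>2"
    using m by (auto simp: r_def)
  have a2: "a2 = 1/2 * (1 + \<sigma> * r)" "\<sigma> = 1 \<or> \<sigma> = -1"
    using assms(4,5) by (auto simp: r_def)
  have "a2 > 0"
    using a2 r by auto
  \<comment> \<open>Squaring removes the sign and gives the quadratic equation for
    \<open>a2\<close>.\<close>
  have "2 * a2 - 1 = \<sigma> * r"
    using a2(1) by simp
  then have "(2 * a2 - 1)\<^sup>2 = r\<^sup>2"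
    using a2(2) by (auto simp: power_mult_distrib)
  then have m2: "m\<^sup>2 = a2 - a2\<^sup>2"
    using r(3) by (simp add: power2_eq_square algebra_simps)
  have "h > 0"
    using \<open>a2 > 0\<close> assms(6) by simp
  have "\<gamma> > 0"
    using \<open>h > 0\<close> assms(2,7) by simp
  have "A = a2 * h"
    using assms(6,8) m2 by (simp add: power2_eq_square algebra_simps)
  then have "A > 0"
    using \<open>a2 > 0\<close> \<open>h > 0\<close> by simp
  \<comment> \<open>With a positive prefactor, the monotonicity of G is that of a power with
    exponent \<open>\<gamma> - 2\<close>.\<close>
  define g where "g = A / (4 * pi * \<rho>0 * \<gamma>)"
  have "g > 0"
    using \<open>A > 0\<close> \<open>\<gamma> > 0\<close> assms(3) by (simp add: g_def)
  have G': "G t = g * (t + t0) powr (\<gamma> - 2)" if "t > - t0" for t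
    using G[OF that] by (simp add: g_def)
  have "bianchi_VI0_solution_on {- t0<..} m \<omega> a b d \<rho> G \<Lambda>"
    by (rule power_law_solution[OF assms(9-14)])
      (use assms(3,6-8) m2 \<open>\<gamma> > 0\<close> in auto)
  moreover have "strict_antimono_on {- t0<..} G \<and> (\<forall>t > - t0. \<Lambda> t < 0)" if "\<gamma> < 2"
  proof -
    have "1 - 2 / \<gamma> < 0"
      using that \<open>\<gamma> > 0\<close> by simp
    then have "\<forall>t > - t0. \<Lambda> t < 0"
      using \<open>A > 0\<close> by (simp add: \<Lambda> mult_pos_neg mult_neg_pos)
    moreover have "strict_antimono_on {- t0<..} G"
      using \<open>g > 0\<close> that by (auto simp: monotone_on_def G' intro!: powr_less_mono2_neg)
    ultimately show ?thesis by blast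
  qed
  \<comment> \<open>The exponent of G and the factor \<open>1 - 2 / \<gamma>\<close> vanish
    together.\<close>
  moreover have "G constant_on {- t0<..} \<and> (\<forall>t > - t0. \<Lambda> t = 0)" if "\<gamma> = 2"
    using that by (auto simp: constant_on_def G' \<Lambda>)
  moreover have "strict_mono_on {- t0<..} G \<and> (\<forall>t > - t0. \<Lambda> t > 0)" if "\<gamma> > 2"
  proof -
    have "1 - 2 / \<gamma> > 0"
      using that by simp
    then have "\<forall>t > - t0. \<Lambda> t > 0"
      using \<open>A > 0\<close> by (simp add: \<Lambda>)
    moreover have "strict_mono_on {- t0<..} G"
      using \<open>g > 0\<close> that by (auto simp: monotone_on_def G' intro!: powr_less_mono2)
    ultimately show ?thesis by blast
  qed
  ultimately show ?thesis
    unfolding assms(7)[symmetric] by blast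
qed

end
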